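(* Let $n\ge 1$ be an integer, let $A\in\mathbb{R}^{n\times n}$, and fix $k\in\{1,\dots,n\}$. Then $$A^{[k]} = L_{n,k}\, A^{\oplus k}\, M_{n,k}.$$
   Context: For integers $n\ge 1$ and $k\in\{1,\dots,n\}$, $Q(n,k)$ denotes the list of all strictly increasing sequences $(i_1,\dots,i_k)$ of $k$ integers in $\{1,\dots,n\}$, ordered lexicographically. For $A\in\mathbb{R}^{n\times m}$ and $k\in\{1,\dots,\min\{n,m\}\}$, the $k$-multiplicative compound $A^{(k)}$ is the $\binom{n}{k}\times\binom{m}{k}$ matrix of all $k\times k$ minors of $A$ in lexicographic order: its entry in the row indexed by $\alpha\in Q(n,k)$ and the column indexed by $\beta\in Q(m,k)$ is the minor of $A$ with rows $\alpha$ and columns $\beta$. In particular, for $x^1,\dots,x^k\in\mathbb{R}^n$, $\begin{bmatrix}x^1&\dots&x^k\end{bmatrix}^{(k)}$ is a column vector in $\mathbb{R}^{\binom{n}{k}}$. For $B\in\mathbb{R}^{n\times n}$, the $k$-additive compound $B^{[k]}$ is the $\binom{n}{k}\times\binom{n}{k}$ matrix that is the coefficient of $\varepsilon^1$ in the expansion $(I_n+\varepsilon B)^{(k)}=L_0+L_1\varepsilon+\dots+L_k\varepsilon^k$, i.e. $B^{[k]}:=L_1$. $\otimes$ is the Kronecker product, and for $A\in\mathbb{R}^{n\times n}$ the $k$th Kronecker sum is $$A^{\oplus k}:=A\otimes I_n\otimes\dots\otimes I_n+I_n\otimes A\otimes I_n\otimes\dots\otimes I_n+\dots+I_n\otimes\dots\otimes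 I_n\otimes A,$$ where every product has $k$ factors (so there are $k$ summands and $A^{\oplus 1}=A$). Let $e^1,\dots,e^n$ be the canonical basis of $\mathbb{R}^n$. The matrices $M_{n,k}\in\mathbb{R}^{n^k\times\binom{n}{k}}$ and $L_{n,k}\in\mathbb{R}^{\binom{n}{k}\times n^k}$ are $$M_{n,k}:=\sum_{(i_1,\dots,i_k)\in Q(n,k)}\ \sum_{(j_1,\dots,j_k)\in S(i_1,\dots,i_k)}\sigma(j_1,\dots,j_k)\,(e^{j_1}\otimes\dots\otimes e^{j_k})\left(\begin{bmatrix}e^{i_1}&\dots&e^{i_k}\end{bmatrix}^{(k)}\right)^T,$$ $$L_{n,k}:=\sum_{(i_1,\dots,i_k)\in Q(n,k)}\begin{bmatrix}e^{i_1}&\dots&e^{i_k}\end{bmatrix}^{(k)}(e^{i_1}\otimes\dots\otimes e^{i_k})^T,$$ where $S(i_1,\dots,i_k)$ is the set of all permutations (rearrangements) of the sequence $(i_1,\dots,i_k)$ and $\sigma(j_1,\dots,j_k)\in\{-1,1\}$ is the signature of the permutation $(j_1,\dots,j_k)$ relative to increasing order. *)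

theory Defs
  imports
    "Jordan_Normal_Form.DL_Submatrix"
    "Jordan_Normal_Form.Determinant"
    "HOL-Combinatorics.Multiset_Permutations"
    "HOL-Library.List_Lexorder"
begin

text \<open>
  Rows, columns and the entries of index sequences are numbered from \<open>0\<close>, as everywhere in the
  matrix library: the integers \<open>1, \<dots>, n\<close> become \<open>0, \<dots>, n - 1\<close>. Column vectors that take part in
  matrix products are matrices with one column.
\<close>

section \<open>Increasing sequences in lexicographic order\<close>

text \<open>The linear order on lists used for sorting is the lexicographic one.\<close>

definition incr_seqs :: "nat \<Rightarrow> nat \<Rightarrow> nat list list" where
  "incr_seqs n k = sorted_list_of_set {xs. length xs = k \<and> sorted_wrt (<) xs \<and> set xs \<subseteq> {0..<n}}"

lemma finite_incr_seqs:
  "finite {xs :: nat list. length xs = k \<and> sorted_wrt (<) xs \<and> set xs \<subseteq> {0..<n}}"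
  by (rule finite_subset[OF _ finite_lists_length_eq[of "{0..<n}" k]]) auto

lemma set_incr_seqs:
  "set (incr_seqs n k) = {xs. length xs = k \<and> sorted_wrt (<) xs \<and> set xs \<subseteq> {0..<n}}"
  unfolding incr_seqs_def using finite_incr_seqs by simp

lemma distinct_incr_seqs: "distinct (incr_seqs n k)"
  unfolding incr_seqs_def by simp

lemma length_incr_seqs: "length (incr_seqs n k) = n choose k"
proof -
  let ?L = "{xs :: nat list. length xs = k \<and> sorted_wrt (<) xs \<and> set xs \<subseteq> {0..<n}}"
  have "bij_betw set ?L {K. K \<subseteq> {0..<n} \<and> card K = k}"
  proof (rule bij_betwI[where g = sorted_list_of_set])
    show "set \<in> ?L \<rightarrow> {K. K \<subseteq> {0..<n} \<and> card K = k}"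
      by (auto simp: strict_sorted_iff distinct_card)
    show "sorted_list_of_set \<in> {K. K \<subseteq> {0..<n} \<and> card K = k} \<rightarrow> ?L"
    proof (rule Pi_I)
      fix K assume K: "K \<in> {K. K \<subseteq> {0..<n} \<and> card K = k}"
      then have "finite K"
        by (auto intro: finite_subset)
      then show "sorted_list_of_set K \<in> ?L"
        using K by simp
    qed
    show "sorted_list_of_set (set xs) = xs" if "xs \<in> ?L" for xs
      using that by (simp add: strict_sorted_iff sorted_list_of_set.idem_if_sorted_distinct)
    show "set (sorted_list_of_set K) = K" if "K \<in> {K. K \<subseteq> {0..<n} \<and> card K = k}" for K
      using that by (auto intro!: set_sorted_list_of_set intro: finite_subset)
  qed
  then have "card ?L = n choose k"
    by (simp add: bij_betw_same_card n_subsets)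
  then show ?thesis
    unfolding incr_seqs_def by simp
qed

section \<open>Compound matrices\<close>

definition mult_compound :: "nat \<Rightarrow> 'a :: comm_ring_1 mat \<Rightarrow> 'a mat" where
  "mult_compound k A = mat (dim_row A choose k) (dim_col A choose k)
     (\<lambda>(i, j). det (submatrix A (set (incr_seqs (dim_row A) k ! i)) (set (incr_seqs (dim_col A) k ! j))))"

lemma pick_incr_seq:
  assumes "sorted_wrt (<) xs" "i < length xs"
  shows "pick (set xs) i = xs ! i"
proof -
  have d: "distinct xs"
    using assms(1) by (simp add: strict_sorted_iff)
  have "{x \<in> set xs. x < xs ! i} = (!) xs ` {..<i}"
  proof (intro equalityI subsetI)
    fix x assume "x \<in> {x \<in> set xs. x < xs ! i}"
    then obtain a where a: "a < length xs" "x = xs ! a" "xs ! a < xs ! i"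
      by (auto simp: in_set_conv_nth)
    have "\<not> i < a"
      using sorted_wrt_nth_less[OF assms(1), of i a] a by auto
    moreover have "a \<noteq> i"
      using a by auto
    ultimately show "x \<in> (!) xs ` {..<i}"
      using a by auto
  next
    fix x assume "x \<in> (!) xs ` {..<i}"
    then show "x \<in> {x \<in> set xs. x < xs ! i}"
      using assms(2) sorted_wrt_nth_less[OF assms(1), of _ i] by auto
  qed
  moreover have "inj_on ((!) xs) {..<i}"
    using d assms(2) by (auto simp: inj_on_def nth_eq_iff_index_eq)
  ultimately have "card {x \<in> set xs. x < xs ! i} = i"
    by (simp add: card_image)
  then show ?thesis
    using pick_card_in_set[of "xs ! i" "set xs"] assms(2) by simp
qed

lemma submatrix_incr_seqs:
  assumes "xs \<in> set (incr_seqs (dim_row A) k)" "ys \<in> set (incr_seqs (dim_col A) k)"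
  shows "submatrix A (set xs) (set ys) = mat k k (\<lambda>(i, j). A $$ (xs ! i, ys ! j))"
proof -
  have x: "length xs = k" "sorted_wrt (<) xs" "set xs \<subseteq> {0..<dim_row A}"
    and y: "length ys = k" "sorted_wrt (<) ys" "set ys \<subseteq> {0..<dim_col A}"
    using assms by (auto simp: set_incr_seqs)
  have "{i. i < dim_row A \<and> i \<in> set xs} = set xs" "{j. j < dim_col A \<and> j \<in> set ys} = set ys"
    using x(3) y(3) by auto
  moreover have "card (set xs) = k" "card (set ys) = k"
    using x y by (auto simp: strict_sorted_iff distinct_card)
  ultimately show ?thesis
    unfolding submatrix_def using x y by (intro eq_matI) (auto simp: pick_incr_seq)
qed

text \<open>The matrix \<open>I + \<epsilon> B\<close> is formed over the polynomial ring in \<open>\<epsilon>\<close>, with \<open>\<epsilon> = [:0, 1:]\<close>.\<close>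

definition add_compound :: "nat \<Rightarrow> 'a :: comm_ring_1 mat \<Rightarrow> 'a mat" where
  "add_compound k B = map_mat (\<lambda>p. poly.coeff p 1)
     (mult_compound k (1\<^sub>m (dim_row B) + [:0, 1:] \<cdot>\<^sub>m map_mat (\<lambda>b. [:b:]) B))"

section \<open>Kronecker products and sums\<close>

definition mat_sum :: "nat \<Rightarrow> nat \<Rightarrow> ('b \<Rightarrow> 'a :: comm_monoid_add mat) \<Rightarrow> 'b set \<Rightarrow> 'a mat" where
  "mat_sum nr nc f S = mat nr nc (\<lambda>(i, j). \<Sum>x\<in>S. f x $$ (i, j))"

lemma mat_sum_empty: "mat_sum nr nc f {} = 0\<^sub>m nr nc"
  by (rule eq_matI) (auto simp: mat_sum_def)

lemma mat_sum_insert: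
  assumes "finite S" "x \<notin> S" "f x \<in> carrier_mat nr nc"
  shows "mat_sum nr nc f (insert x S) = f x + mat_sum nr nc f S"
  using assms by (intro eq_matI) (auto simp: mat_sum_def)

definition kron :: "'a :: times mat \<Rightarrow> 'a mat \<Rightarrow> 'a mat" where
  "kron A B = mat (dim_row A * dim_row B) (dim_col A * dim_col B)
     (\<lambda>(i, j). A $$ (i div dim_row B, j div dim_col B) * B $$ (i mod dim_row B, j mod dim_col B))"

lemma kron_one_right: "kron A (1\<^sub>m 1) = (A :: 'a :: semiring_1 mat)"
  by (rule eq_matI) (auto simp: kron_def)

fun kron_list :: "'a :: semiring_1 mat list \<Rightarrow> 'a mat" where
  "kron_list [] = 1\<^sub>m 1"
| "kron_list (A # As) = kron A (kron_list As)"

definition kron_sum :: "nat \<Rightarrow> 'a :: semiring_1 mat \<Rightarrow> 'a mat" where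
  "kron_sum k A = mat_sum (dim_row A ^ k) (dim_col A ^ k)
     (\<lambda>l. kron_list ((replicate k (1\<^sub>m (dim_row A)))[l := A])) {0..<k}"

section \<open>The matrices \<open>M\<close> and \<open>L\<close>\<close>

text \<open>The permutation is unique if the entries of the sequence are distinct.\<close>

definition seq_sign :: "nat list \<Rightarrow> int" where
  "seq_sign js = sign (THE p. p permutes {..<length js} \<and> permute_list p (sort js) = js)"

lemma seq_sign_permute_list:
  assumes "sorted_wrt (<) xs" "p permutes {..<length xs}"
  shows "seq_sign (permute_list p xs) = sign p"
proof -
  have d: "distinct xs" "sorted xs"
    using assms(1) by (auto simp: strict_sorted_iff)
  have "sort (permute_list p xs) = sort xs"
    by (rule properties_for_sort) (use assms(2) in \<open>auto simp: mset_permute_list\<close>)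
  then have s: "sort (permute_list p xs) = xs"
    using d(2) by (simp add: sorted_sort_id)
  have "(THE q. q permutes {..<length xs} \<and> permute_list q xs = permute_list p xs) = p"
  proof (rule the_equality)
    fix q assume q: "q permutes {..<length xs} \<and> permute_list q xs = permute_list p xs"
    show "q = p"
    proof
      fix i
      show "q i = p i"
      proof (cases "i < length xs")
        case True
        have "xs ! q i = xs ! p i"
          using q True assms(2) permute_list_nth[of p xs i] permute_list_nth[of q xs i] by simp
        moreover have "q i < length xs" "p i < length xs"
          using q True permutes_in_image[of p "{..<length xs}" i] permutes_in_image[of q "{..<length xs}" i] assms(2)
          by auto
        ultimately show ?thesis
          using d(1) by (simp add: nth_eq_iff_index_eq)
      next
        case False
        then show ?thesis
          using q assms(2) by (simp add: permutes_def)
      qed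
    qed
  qed (use assms(2) in simp)
  then show ?thesis
    unfolding seq_sign_def s by simp
qed

definition basis_cols :: "nat \<Rightarrow> nat list \<Rightarrow> 'a :: semiring_1 mat" where
  "basis_cols n xs = mat_of_cols n (map (unit_vec n) xs)"

definition basis_kron :: "nat \<Rightarrow> nat list \<Rightarrow> 'a :: semiring_1 mat" where
  "basis_kron n xs = kron_list (map (\<lambda>j. basis_cols n [j]) xs)"

definition M_mat :: "nat \<Rightarrow> nat \<Rightarrow> 'a :: comm_ring_1 mat" where
  "M_mat n k = mat_sum (n ^ k) (n choose k)
     (\<lambda>is. mat_sum (n ^ k) (n choose k)
       (\<lambda>js. of_int (seq_sign js) \<cdot>\<^sub>m (basis_kron n js * transpose_mat (mult_compound k (basis_cols n is))))
       (permutations_of_multiset (mset is)))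
     (set (incr_seqs n k))"

definition L_mat :: "nat \<Rightarrow> nat \<Rightarrow> 'a :: comm_ring_1 mat" where
  "L_mat n k = mat_sum (n choose k) (n ^ k)
     (\<lambda>is. mult_compound k (basis_cols n is) * transpose_mat (basis_kron n is))
     (set (incr_seqs n k))"

end

theory Submission
  imports Defs
begin

text \<open>
  Both sides are the alternating part of the derivation that \<open>A\<close> induces on the \<open>k\<close>-fold tensor
  power. Index the rows and columns of a \<open>k\<close>-fold Kronecker product by sequences of length \<open>k\<close>
  instead of numbers. In this indexing the Kronecker product of \<open>A\<^sub>1, \<dots>, A\<^sub>k\<close> has the entry
  \<open>\<Prod>m. A\<^sub>m $$ (x m, y m)\<close> at \<open>(x, y)\<close> (lemma \<open>kron_list_index\<close>), row \<open>\<alpha>\<close> of \<open>L\<close> is the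
  unit vector at the sequence \<open>\<alpha>\<close>, and column \<open>\<beta>\<close> of \<open>M\<close> is the sum of the unit vectors at the
  rearrangements of \<open>\<beta>\<close>, each weighted by its sign. Hence, for every \<open>X\<close>, the product \<open>L X M\<close>
  antisymmetrizes the columns of \<open>X\<close> (lemma \<open>L_mult_M_index\<close>): its entry at \<open>(\<alpha>, \<beta>)\<close> is
  \<open>\<Sum>p. sign p * X $$ (\<alpha>, \<beta> \<circ> p)\<close>.

  For the Kronecker sum this is \<open>\<Sum>p. sign p * (\<Sum>l. \<Prod>m. c p l m)\<close> (lemma
  \<open>kron_sum_index\<close>), where \<open>c p l m\<close> is the entry at \<open>(\<alpha> m, \<beta> (p m))\<close> of \<open>A\<close> if \<open>m = l\<close> and of
  the identity otherwise. By the product rule (lemma \<open>coeff_1_prod\<close>), the sum over \<open>l\<close> is the linear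
  coefficient of \<open>\<Prod>m. (I + \<epsilon> A) $$ (\<alpha> m, \<beta> (p m))\<close>. The whole is therefore the linear coefficient
  of the Leibniz expansion of the minor of \<open>I + \<epsilon> A\<close> with rows \<open>\<alpha>\<close> and columns \<open>\<beta>\<close>, which is the
  entry of the additive compound (lemma \<open>add_compound_index\<close>).
\<close>

section \<open>Sequences as indices of Kronecker products\<close>

lemma nth_less_bound:
  assumes "set xs \<subseteq> {0..<n}" "i < length xs"
  shows "xs ! i < n"
  using subsetD[OF assms(1) nth_mem[OF assms(2)]] by simp

text \<open>
  The value of a sequence of base \<open>n\<close> digits, most significant digit first. This is the order in
  which \<^const>\<open>kron\<close> enumerates pairs of indices.
\<close>

primrec seq_index :: "nat \<Rightarrow> nat list \<Rightarrow> nat" where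
  "seq_index n [] = 0"
| "seq_index n (x # xs) = x * n ^ length xs + seq_index n xs"

lemma seq_index_less:
  assumes "set xs \<subseteq> {0..<n}"
  shows "seq_index n xs < n ^ length xs"
  using assms
proof (induction xs)
  case (Cons x xs)
  then have "seq_index n xs < n ^ length xs" "Suc x \<le> n"
    by auto
  then have "seq_index n (x # xs) < Suc x * n ^ length xs" "Suc x * n ^ length xs \<le> n * n ^ length xs"
    by (auto simp del: mult_Suc intro: mult_le_mono1) simp
  then show ?case
    by simp
qed simp

lemma seq_index_replicate_0: "seq_index n (replicate k 0) = 0"
  by (induction k) auto

lemma div_mod_seq_index_Cons:
  assumes "set xs \<subseteq> {0..<n}"
  shows "seq_index n (x # xs) div n ^ length xs = x"
    and "seq_index n (x # xs) mod n ^ length xs = seq_index n xs"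
  using seq_index_less[OF assms] gr_implies_not_zero[OF seq_index_less[OF assms]]
  by (simp_all del: power_eq_0_iff power_not_zero)

definition seqs :: "nat \<Rightarrow> nat \<Rightarrow> nat list set" where
  "seqs n k = {xs. set xs \<subseteq> {0..<n} \<and> length xs = k}"

lemma finite_seqs: "finite (seqs n k)"
  unfolding seqs_def by (rule finite_lists_length_eq) simp

lemma seq_index_inject:
  assumes "length xs = length ys" "set xs \<subseteq> {0..<n}" "set ys \<subseteq> {0..<n}"
    and "seq_index n xs = seq_index n ys"
  shows "xs = ys"
  using assms
proof (induction xs ys rule: list_induct2)
  case (Cons x xs y ys)
  have "x = y" "seq_index n xs = seq_index n ys"
    using div_mod_seq_index_Cons[of xs n x] div_mod_seq_index_Cons[of ys n y] Cons.prems Cons.hyps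
    by simp_all
  then show ?case
    using Cons by simp
qed simp

lemma bij_betw_seq_index: "bij_betw (seq_index n) (seqs n k) {0..<n ^ k}"
proof -
  have inj: "inj_on (seq_index n) (seqs n k)"
    by (auto simp: inj_on_def seqs_def intro: seq_index_inject)
  have "seq_index n ` seqs n k \<subseteq> {0..<n ^ k}"
    using seq_index_less by (auto simp: seqs_def)
  moreover have "card (seq_index n ` seqs n k) = n ^ k"
    using card_image[OF inj] card_lists_length_eq[of "{0..<n}" k] by (simp add: seqs_def)
  ultimately have "seq_index n ` seqs n k = {0..<n ^ k}"
    by (intro card_subset_eq) auto
  with inj show ?thesis
    by (simp add: bij_betw_def)
qed

lemma kron_list_carrier:
  assumes "set As \<subseteq> carrier_mat r c"
  shows "kron_list As \<in> carrier_mat (r ^ length As) (c ^ length As)"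
  using assms by (induction As) (force simp: kron_def)+

text \<open>
  The leading digits of a row and a column index select an entry of the first factor, the remaining
  digits an entry of the product of the other factors.
\<close>

lemma kron_list_index:
  fixes As :: "'a :: comm_semiring_1 mat list"
  assumes "set As \<subseteq> carrier_mat r c"
    and "xs \<in> seqs r (length As)" "ys \<in> seqs c (length As)"
  shows "kron_list As $$ (seq_index r xs, seq_index c ys)
    = (\<Prod>m<length As. (As ! m) $$ (xs ! m, ys ! m))"
  using assms
proof (induction As arbitrary: xs ys)
  case (Cons A As)
  obtain x xs' y ys' where xy: "xs = x # xs'" "ys = y # ys'"
    using Cons.prems(2,3) by (cases xs; cases ys) (auto simp: seqs_def)
  have s: "xs' \<in> seqs r (length As)" "ys' \<in> seqs c (length As)"
    using Cons.prems(2,3) by (auto simp: xy seqs_def)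
  have A: "A \<in> carrier_mat r c" and As: "kron_list As \<in> carrier_mat (r ^ length As) (c ^ length As)"
    using Cons.prems(1) kron_list_carrier[of As r c] by auto
  have l: "length xs' = length As" "length ys' = length As"
    using s by (auto simp: seqs_def)
  have b: "seq_index r xs < r * r ^ length As" "seq_index c ys < c * c ^ length As"
    using seq_index_less[of xs r] seq_index_less[of ys c] Cons.prems(2,3)
    by (auto simp: seqs_def)
  have dm: "seq_index r xs div r ^ length As = x" "seq_index r xs mod r ^ length As = seq_index r xs'"
    "seq_index c ys div c ^ length As = y" "seq_index c ys mod c ^ length As = seq_index c ys'"
    using div_mod_seq_index_Cons[of xs' r x] div_mod_seq_index_Cons[of ys' c y] s l
    by (auto simp: xy seqs_def)
  have "kron_list (A # As) $$ (seq_index r xs, seq_index c ys)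
      = A $$ (x, y) * kron_list As $$ (seq_index r xs', seq_index c ys')"
    using A As b dm by (simp add: kron_def)
  also have "\<dots> = A $$ (x, y) * (\<Prod>m<length As. (As ! m) $$ (xs' ! m, ys' ! m))"
    using Cons.IH[OF _ s] Cons.prems(1) by simp
  also have "\<dots> = (\<Prod>m<length (A # As). ((A # As) ! m) $$ (xs ! m, ys ! m))"
    by (simp add: prod.lessThan_Suc_shift xy del: prod.lessThan_Suc)
  finally show ?case .
qed (simp add: seqs_def)

lemma prod_of_bool:
  assumes "finite S"
  shows "(\<Prod>m\<in>S. of_bool (P m)) = (of_bool (\<forall>m\<in>S. P m) :: 'a :: comm_semiring_1)"
  using assms by (induction S) auto

lemma basis_cols_carrier: "basis_cols n xs \<in> carrier_mat n (length xs)"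
  by (auto simp: basis_cols_def)

lemma basis_cols_index:
  assumes "i < n" "c < length xs"
  shows "basis_cols n xs $$ (i, c) = of_bool (i = xs ! c)"
  using assms by (simp add: basis_cols_def mat_of_cols_def unit_vec_def)

lemma basis_kron_carrier: "(basis_kron n js :: 'a :: semiring_1 mat) \<in> carrier_mat (n ^ length js) 1"
  using kron_list_carrier[of "map (\<lambda>j. basis_cols n [j] :: 'a mat) js" n 1]
    basis_cols_carrier[of n "[_]", where 'a = 'a]
  by (simp add: basis_kron_def image_subset_iff)

lemma basis_kron_index:
  assumes "xs \<in> seqs n k" "js \<in> seqs n k"
  shows "(basis_kron n js :: 'a :: comm_semiring_1 mat) $$ (seq_index n xs, 0) = of_bool (xs = js)"
proof -
  let ?As = "map (\<lambda>j. basis_cols n [j] :: 'a mat) js"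
  have l: "length xs = k" "length js = k" "set xs \<subseteq> {0..<n}" "set js \<subseteq> {0..<n}"
    using assms by (auto simp: seqs_def)
  \<comment> \<open>The only column of \<^const>\<open>basis_kron\<close> has the sequence \<open>0, \<dots>, 0\<close> as its index.\<close>
  have "replicate k 0 \<in> seqs 1 k"
    by (auto simp: seqs_def)
  then have "kron_list ?As $$ (seq_index n xs, seq_index 1 (replicate k 0))
    = (\<Prod>m<k. (?As ! m) $$ (xs ! m, replicate k 0 ! m))"
    using kron_list_index[of ?As n 1 xs "replicate k 0"] assms l
      basis_cols_carrier[of n "[_]", where 'a = 'a]
    by (simp add: image_subset_iff)
  also have "\<dots> = (\<Prod>m<k. of_bool (xs ! m = js ! m))"
  proof (rule prod.cong[OF refl])
    fix m assume "m \<in> {..<k}"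
    moreover from this have "xs ! m < n"
      using l by (simp add: nth_less_bound)
    ultimately show "(?As ! m) $$ (xs ! m, replicate k 0 ! m) = of_bool (xs ! m = js ! m)"
      using l by (auto simp: basis_cols_index)
  qed
  also have "\<dots> = of_bool (xs = js)"
    using l by (simp add: prod_of_bool list_eq_iff_nth_eq Ball_def)
  finally show ?thesis
    by (simp add: basis_kron_def seq_index_replicate_0)
qed

section \<open>Compounds\<close>

lemma incr_seqs_in_seqs: "xs \<in> set (incr_seqs n k) \<Longrightarrow> xs \<in> seqs n k"
  by (auto simp: set_incr_seqs seqs_def)

lemma incr_seqs_nth_mem: "i < n choose k \<Longrightarrow> incr_seqs n k ! i \<in> set (incr_seqs n k)"
  by (simp add: length_incr_seqs)

lemma mult_compound_index:
  assumes "i < dim_row A choose k" "j < dim_col A choose k"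
  shows "mult_compound k A $$ (i, j) = det (mat k k (\<lambda>(r, c).
    A $$ (incr_seqs (dim_row A) k ! i ! r, incr_seqs (dim_col A) k ! j ! c)))"
  using assms submatrix_incr_seqs[OF incr_seqs_nth_mem[OF assms(1)] incr_seqs_nth_mem[OF assms(2)]]
  unfolding mult_compound_def by simp

lemma incr_seqs_diagonal: "incr_seqs k k = [[0..<k]]"
proof -
  have "incr_seqs k k = [incr_seqs k k ! 0]"
    by (rule nth_equalityI) (simp_all add: length_incr_seqs)
  moreover have "[0..<k] \<in> set (incr_seqs k k)"
    by (simp add: set_incr_seqs strict_sorted_iff)
  ultimately show ?thesis
    by (metis empty_set singletonD list.simps(15))
qed

lemma basis_compound_carrier:
  "length xs = k \<Longrightarrow> mult_compound k (basis_cols n xs) \<in> carrier_mat (n choose k) 1"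
  by (auto simp: mult_compound_def basis_cols_def)

text \<open>
  The compound of the columns \<open>e\<^sup>i\<close>, \<open>i \<in> xs\<close>, is a unit vector: if a row sequence \<open>\<alpha>\<close> differs
  from \<open>xs\<close>, then it has an entry outside \<open>xs\<close>, since both are increasing and of the same length.
  This entry gives a zero row in the minor.
\<close>

lemma basis_compound_index:
  assumes "a < n choose k" "xs \<in> set (incr_seqs n k)"
  shows "(mult_compound k (basis_cols n xs) :: 'a :: comm_ring_1 mat) $$ (a, 0)
    = of_bool (xs = incr_seqs n k ! a)"
proof -
  define \<alpha> where "\<alpha> = incr_seqs n k ! a"
  have \<alpha>: "length \<alpha> = k" "sorted_wrt (<) \<alpha>" "set \<alpha> \<subseteq> {0..<n}"
    using incr_seqs_nth_mem[OF assms(1)] by (auto simp: \<alpha>_def set_incr_seqs)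
  have xs: "length xs = k" "sorted_wrt (<) xs" "set xs \<subseteq> {0..<n}"
    using assms(2) by (auto simp: set_incr_seqs)
  let ?B = "mat k k (\<lambda>(r, c). of_bool (\<alpha> ! r = xs ! c)) :: 'a mat"
  have "(mult_compound k (basis_cols n xs) :: 'a mat) $$ (a, 0)
    = det (mat k k (\<lambda>(r, c). basis_cols n xs $$ (\<alpha> ! r, [0..<k] ! c)))"
    using mult_compound_index[of a "basis_cols n xs :: 'a mat" k 0] assms(1) xs
    by (simp add: basis_cols_def incr_seqs_diagonal \<alpha>_def)
  also have "mat k k (\<lambda>(r, c). basis_cols n xs $$ (\<alpha> ! r, [0..<k] ! c)) = ?B"
  proof (rule eq_matI)
    fix r c assume "r < dim_row ?B" "c < dim_col ?B"
    moreover from this have "\<alpha> ! r < n"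
      using \<alpha> by (simp add: nth_less_bound)
    ultimately show "mat k k (\<lambda>(r, c). basis_cols n xs $$ (\<alpha> ! r, [0..<k] ! c)) $$ (r, c)
        = ?B $$ (r, c)"
      using \<alpha> xs by (auto simp: basis_cols_index)
  qed simp_all
  also have "det ?B = of_bool (xs = \<alpha>)"
  proof (cases "xs = \<alpha>")
    case True
    then have "?B = 1\<^sub>m k"
      using \<alpha> by (intro eq_matI) (auto simp: nth_eq_iff_index_eq strict_sorted_iff)
    then show ?thesis
      using True by simp
  next
    case False
    have c: "card (set \<alpha>) = k" "card (set xs) = k"
      using \<alpha> xs by (auto simp: strict_sorted_iff distinct_card)
    have "set \<alpha> \<noteq> set xs"
      using False \<alpha>(2) xs(2) by (auto simp: strict_sorted_iff dest: sorted_distinct_set_unique)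
    then have "\<not> set \<alpha> \<subseteq> set xs"
      using c card_subset_eq[of "set xs" "set \<alpha>"] by auto
    then obtain r where r: "r < k" "\<alpha> ! r \<notin> set xs"
      using \<alpha>(1) by (auto simp: subset_iff in_set_conv_nth)
    have "(\<Prod>i = 0..<k. ?B $$ (i, p i)) = 0" if p: "p permutes {0..<k}" for p
    proof (rule prod_zero)
      have "p r < k"
        using permutes_in_image[OF p, of r] r by simp
      then show "\<exists>i\<in>{0..<k}. ?B $$ (i, p i) = 0"
        using r xs(1) by (intro bexI[of _ r]) auto
    qed simp
    then show ?thesis
      using False by (simp add: det_def)
  qed
  finally show ?thesis
    by (simp add: \<alpha>_def)
qed

section \<open>Antisymmetrization\<close>

lemma outer_product_index:
  fixes u v :: "'a :: comm_semiring_1 mat"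
  assumes "u \<in> carrier_mat r 1" "v \<in> carrier_mat c 1" "i < r" "j < c"
  shows "(u * transpose_mat v) $$ (i, j) = u $$ (i, 0) * v $$ (j, 0)"
  using assms by (simp add: scalar_prod_def)

lemma L_mat_index:
  assumes "a < n choose k" "xs \<in> seqs n k"
  shows "(L_mat n k :: 'a :: comm_ring_1 mat) $$ (a, seq_index n xs)
    = of_bool (xs = incr_seqs n k ! a)"
proof -
  let ?Q = "set (incr_seqs n k)"
  have b: "seq_index n xs < n ^ k"
    using seq_index_less[of xs n] assms(2) by (auto simp: seqs_def)
  have "(L_mat n k :: 'a mat) $$ (a, seq_index n xs)
    = (\<Sum>is\<in>?Q. (mult_compound k (basis_cols n is) * transpose_mat (basis_kron n is)) $$ (a, seq_index n xs))"
    using assms(1) b by (simp add: L_mat_def mat_sum_def)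
  also have "\<dots> = (\<Sum>is\<in>?Q. if is = incr_seqs n k ! a then of_bool (xs = is) else 0)"
  proof (rule sum.cong[OF refl])
    fix "is" assume i: "is \<in> ?Q"
    have l: "length is = k"
      using i by (auto simp: set_incr_seqs)
    have "(mult_compound k (basis_cols n is) * transpose_mat (basis_kron n is)) $$ (a, seq_index n xs)
      = mult_compound k (basis_cols n is) $$ (a, 0) * (basis_kron n is :: 'a mat) $$ (seq_index n xs, 0)"
      using basis_compound_carrier[OF l, of n] basis_kron_carrier[of n "is"] l assms(1) b
      by (intro outer_product_index) auto
    then show "(mult_compound k (basis_cols n is) * transpose_mat (basis_kron n is)) $$ (a, seq_index n xs)
      = (if is = incr_seqs n k ! a then of_bool (xs = is) else 0 :: 'a)"
      using basis_compound_index[OF assms(1) i, where 'a = 'a]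
        basis_kron_index[OF assms(2) incr_seqs_in_seqs[OF i], where 'a = 'a]
      by simp
  qed
  also have "\<dots> = of_bool (xs = incr_seqs n k ! a)"
    using incr_seqs_nth_mem[OF assms(1)] by simp
  finally show ?thesis .
qed

lemma M_mat_index:
  assumes "b < n choose k" "xs \<in> seqs n k"
  shows "(M_mat n k :: 'a :: comm_ring_1 mat) $$ (seq_index n xs, b)
    = (if mset xs = mset (incr_seqs n k ! b) then of_int (seq_sign xs) else 0)"
proof -
  let ?Q = "set (incr_seqs n k)"
  let ?P = "\<lambda>is. permutations_of_multiset (mset is)"
  let ?T = "\<lambda>is js. of_int (seq_sign js) \<cdot>\<^sub>m
    (basis_kron n js * transpose_mat (mult_compound k (basis_cols n is))) :: 'a mat"
  have c: "seq_index n xs < n ^ k"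
    using seq_index_less[of xs n] assms(2) by (auto simp: seqs_def)
  have T: "?T is js $$ (seq_index n xs, b)
      = (if is = incr_seqs n k ! b then if js = xs then of_int (seq_sign js) else 0 else 0)"
    if i: "is \<in> ?Q" and j: "js \<in> ?P is" for "is" js
  proof -
    have m: "mset js = mset is"
      using j by (simp add: permutations_of_multiset_def)
    have l: "length is = k" "length js = k" and js: "js \<in> seqs n k"
      using i mset_eq_length[OF m] mset_eq_setD[OF m] by (auto simp: set_incr_seqs seqs_def)
    define P :: "'a mat" where
      "P = basis_kron n js * transpose_mat (mult_compound k (basis_cols n is))"
    have "P $$ (seq_index n xs, b)
      = basis_kron n js $$ (seq_index n xs, 0) * mult_compound k (basis_cols n is) $$ (b, 0)"
      unfolding P_def
      using basis_compound_carrier[OF l(1), of n] basis_kron_carrier[of n js] l assms(1) c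
      by (intro outer_product_index) auto
    also have "\<dots> = of_bool (xs = js) * of_bool (is = incr_seqs n k ! b)"
      by (simp only: basis_compound_index[OF assms(1) i] basis_kron_index[OF assms(2) js])
    finally have "P $$ (seq_index n xs, b) = of_bool (xs = js) * of_bool (is = incr_seqs n k ! b)" .
    moreover have "P \<in> carrier_mat (n ^ k) (n choose k)"
      using basis_compound_carrier[OF l(1), of n, where 'a = 'a]
        basis_kron_carrier[of n js, where 'a = 'a] l by (auto simp: P_def)
    ultimately show ?thesis
      unfolding P_def[symmetric] using c assms(1) by auto
  qed
  have "(M_mat n k :: 'a mat) $$ (seq_index n xs, b)
    = (\<Sum>is\<in>?Q. \<Sum>js\<in>?P is. ?T is js $$ (seq_index n xs, b))"
    using assms(1) c by (simp add: M_mat_def mat_sum_def)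
  also have "\<dots> = (\<Sum>is\<in>?Q. if is = incr_seqs n k ! b then
      \<Sum>js\<in>?P is. if js = xs then of_int (seq_sign js) else 0 else 0)"
    using T by (intro sum.cong refl) auto
  also have "\<dots> = (if xs \<in> ?P (incr_seqs n k ! b) then of_int (seq_sign xs) else 0)"
    using incr_seqs_nth_mem[OF assms(1)] by simp
  finally show ?thesis
    by (simp add: permutations_of_multiset_def)
qed

lemma bij_betw_permute_list:
  assumes "distinct xs"
  shows "bij_betw (\<lambda>p. permute_list p xs) {p. p permutes {..<length xs}} {ys. mset ys = mset xs}"
  unfolding bij_betw_def
proof (intro conjI inj_onI equalityI subsetI)
  fix p q assume pq: "p \<in> {p. p permutes {..<length xs}}" "q \<in> {p. p permutes {..<length xs}}"
    and eq: "permute_list p xs = permute_list q xs"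
  show "p = q"
  proof
    fix i
    show "p i = q i"
    proof (cases "i < length xs")
      case True
      then have "xs ! p i = xs ! q i" "p i < length xs" "q i < length xs"
        using pq eq permute_list_nth[of p xs i] permute_list_nth[of q xs i]
          permutes_in_image[of p "{..<length xs}" i] permutes_in_image[of q "{..<length xs}" i]
        by auto
      then show ?thesis
        using assms by (simp add: nth_eq_iff_index_eq)
    next
      case False
      then show ?thesis
        using pq by (simp add: permutes_def)
    qed
  qed
next
  fix ys assume "ys \<in> {ys. mset ys = mset xs}"
  then show "ys \<in> (\<lambda>p. permute_list p xs) ` {p. p permutes {..<length xs}}"
    by (auto elim: mset_eq_permutation)
qed auto

lemma L_mat_carrier: "L_mat n k \<in> carrier_mat (n choose k) (n ^ k)"
  by (simp add: L_mat_def mat_sum_def)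

lemma M_mat_carrier: "M_mat n k \<in> carrier_mat (n ^ k) (n choose k)"
  by (simp add: M_mat_def mat_sum_def)

lemma mat_mult_index_sum:
  assumes "A \<in> carrier_mat r m" "B \<in> carrier_mat m c" "i < r" "j < c"
  shows "(A * B) $$ (i, j) = (\<Sum>l\<in>{0..<m}. A $$ (i, l) * B $$ (l, j))"
  using assms by (simp add: scalar_prod_def)

text \<open>
  Applied to a Kronecker power of \<open>A\<close> in place of \<open>X\<close>, the right-hand side is the Leibniz expansion
  of a minor of \<open>A\<close>; this is why \<open>L\<close> and \<open>M\<close> turn Kronecker constructions into compounds.
\<close>

lemma L_mult_M_index:
  fixes X :: "'a :: comm_ring_1 mat"
  assumes X: "X \<in> carrier_mat (n ^ k) (n ^ k)" and ab: "a < n choose k" "b < n choose k"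
  shows "(L_mat n k * X * M_mat n k) $$ (a, b)
    = (\<Sum>p | p permutes {..<k}. of_int (sign p) *
        X $$ (seq_index n (incr_seqs n k ! a), seq_index n (permute_list p (incr_seqs n k ! b))))"
proof -
  define \<alpha> \<beta> where "\<alpha> = incr_seqs n k ! a" and "\<beta> = incr_seqs n k ! b"
  have \<alpha>: "\<alpha> \<in> seqs n k"
    using incr_seqs_nth_mem[OF ab(1)] incr_seqs_in_seqs by (simp add: \<alpha>_def)
  have \<beta>: "length \<beta> = k" "sorted_wrt (<) \<beta>" "set \<beta> \<subseteq> {0..<n}"
    using incr_seqs_nth_mem[OF ab(2)] by (auto simp: \<beta>_def set_incr_seqs)
  have reindex: "(\<Sum>j\<in>{0..<n ^ k}. f j) = (\<Sum>xs\<in>seqs n k. f (seq_index n xs))" for f :: "nat \<Rightarrow> 'a"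
    by (rule sum.reindex_bij_betw[OF bij_betw_seq_index, symmetric])
  have LX: "(L_mat n k * X) $$ (a, j) = X $$ (seq_index n \<alpha>, j)" if "j < n ^ k" for j
  proof -
    have "(L_mat n k * X) $$ (a, j)
      = (\<Sum>xs\<in>seqs n k. L_mat n k $$ (a, seq_index n xs) * X $$ (seq_index n xs, j))"
      by (simp add: mat_mult_index_sum[OF L_mat_carrier X ab(1) that] reindex)
    also have "\<dots> = (\<Sum>xs\<in>seqs n k. if xs = \<alpha> then X $$ (seq_index n xs, j) else 0)"
      using ab(1) by (intro sum.cong refl) (simp add: L_mat_index \<alpha>_def)
    also have "\<dots> = X $$ (seq_index n \<alpha>, j)"
      using \<alpha> finite_seqs by simp
    finally show ?thesis .
  qed
  \<comment> \<open>Only the rearrangements of \<open>\<beta>\<close> meet column \<open>b\<close> of \<open>M\<close>; they correspond to the permutations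
    of positions because the entries of \<open>\<beta>\<close> are distinct.\<close>
  have subset: "{ys. mset ys = mset \<beta>} \<subseteq> seqs n k"
    using \<beta> by (auto simp: seqs_def dest: mset_eq_length mset_eq_setD)
  have "(L_mat n k * X * M_mat n k) $$ (a, b)
    = (\<Sum>xs\<in>seqs n k. (L_mat n k * X) $$ (a, seq_index n xs) * M_mat n k $$ (seq_index n xs, b))"
    using mat_mult_index_sum[OF mult_carrier_mat[OF L_mat_carrier X] M_mat_carrier ab]
    by (simp add: reindex)
  also have "\<dots> = (\<Sum>xs\<in>seqs n k. if mset xs = mset \<beta>
      then of_int (seq_sign xs) * X $$ (seq_index n \<alpha>, seq_index n xs) else 0)"
  proof (rule sum.cong[OF refl])
    fix xs assume xs: "xs \<in> seqs n k"
    have "seq_index n xs < n ^ k"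
      using seq_index_less[of xs n] xs by (auto simp: seqs_def)
    then show "(L_mat n k * X) $$ (a, seq_index n xs) * M_mat n k $$ (seq_index n xs, b)
      = (if mset xs = mset \<beta> then of_int (seq_sign xs) * X $$ (seq_index n \<alpha>, seq_index n xs) else 0)"
      by (simp add: LX M_mat_index[OF ab(2) xs] \<beta>_def mult.commute)
  qed
  also have "\<dots> = (\<Sum>xs | mset xs = mset \<beta>.
      of_int (seq_sign xs) * X $$ (seq_index n \<alpha>, seq_index n xs))"
    using subset finite_seqs by (intro sum.mono_neutral_cong_right) auto
  also have "\<dots> = (\<Sum>p | p permutes {..<k}.
      of_int (seq_sign (permute_list p \<beta>)) * X $$ (seq_index n \<alpha>, seq_index n (permute_list p \<beta>)))"
    using bij_betw_permute_list[of \<beta>] \<beta>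
    by (intro sum.reindex_bij_betw[symmetric]) (simp add: strict_sorted_iff)
  also have "\<dots> = (\<Sum>p | p permutes {..<k}.
      of_int (sign p) * X $$ (seq_index n \<alpha>, seq_index n (permute_list p \<beta>)))"
    using \<beta> by (intro sum.cong refl) (simp add: seq_sign_permute_list)
  finally show ?thesis
    by (simp add: \<alpha>_def \<beta>_def)
qed

section \<open>Linear coefficients\<close>

lemma coeff_0_prod: "poly.coeff (\<Prod>m\<in>S. f m) 0 = (\<Prod>m\<in>S. poly.coeff (f m) 0)"
  by (induction S rule: infinite_finite_induct) (auto simp: mult_poly_0_left coeff_mult_0)

text \<open>
  The product rule at \<open>\<epsilon> = 0\<close>, with the omitted factor \<open>m = l\<close> kept in the product so that the terms
  look like the entries of the summands of a Kronecker sum.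
\<close>

lemma coeff_1_prod:
  fixes f :: "'b \<Rightarrow> 'a :: comm_semiring_1 poly"
  assumes "finite S"
  shows "poly.coeff (\<Prod>m\<in>S. f m) 1
    = (\<Sum>l\<in>S. \<Prod>m\<in>S. if m = l then poly.coeff (f m) 1 else poly.coeff (f m) 0)"
  using assms
proof (induction S)
  case (insert x S)
  let ?c = "\<lambda>l m. if m = l then poly.coeff (f m) 1 else poly.coeff (f m) 0"
  have "(\<Prod>m\<in>S. ?c x m) = poly.coeff (\<Prod>m\<in>S. f m) 0"
    unfolding coeff_0_prod using insert.hyps by (intro prod.cong) auto
  moreover have "(\<Sum>l\<in>S. \<Prod>m\<in>insert x S. ?c l m)
      = (\<Sum>l\<in>S. poly.coeff (f x) 0 * (\<Prod>m\<in>S. ?c l m))"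
    using insert.hyps by (intro sum.cong) auto
  ultimately show ?case
    using insert by (simp add: coeff_mult sum_distrib_left add.commute)
qed simp

lemma det_mat:
  "det (mat k k f) = (\<Sum>p | p permutes {..<k}. of_int (sign p) * (\<Prod>m<k. f (m, p m)))"
proof -
  have "(\<Prod>m<k. mat k k f $$ (m, p m)) = (\<Prod>m<k. f (m, p m))" if "p permutes {..<k}" for p
    using permutes_in_image[OF that] by (intro prod.cong) auto
  then show ?thesis
    by (simp add: det_def atLeast0LessThan)
qed

lemma add_compound_index:
  fixes A :: "'a :: comm_ring_1 mat"
  assumes A: "A \<in> carrier_mat n n" and ab: "a < n choose k" "b < n choose k"
  shows "add_compound k A $$ (a, b) = (\<Sum>p | p permutes {..<k}. of_int (sign p) *
    (\<Sum>l<k. \<Prod>m<k. (if m = l then A else 1\<^sub>m n) $$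
      (incr_seqs n k ! a ! m, incr_seqs n k ! b ! p m)))"
proof -
  define \<alpha> \<beta> where "\<alpha> = incr_seqs n k ! a" and "\<beta> = incr_seqs n k ! b"
  have \<alpha>: "\<alpha> ! m < n" "\<beta> ! m < n" if "m < k" for m
  proof -
    have "length \<alpha> = k" "set \<alpha> \<subseteq> {0..<n}" "length \<beta> = k" "set \<beta> \<subseteq> {0..<n}"
      using incr_seqs_nth_mem[OF ab(1)] incr_seqs_nth_mem[OF ab(2)]
      by (auto simp: \<alpha>_def \<beta>_def set_incr_seqs)
    then show "\<alpha> ! m < n" "\<beta> ! m < n"
      using that by (simp_all add: nth_less_bound)
  qed
  let ?E = "1\<^sub>m n + [:0, 1:] \<cdot>\<^sub>m map_mat (\<lambda>b. [:b:]) A"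
  have E: "poly.coeff (?E $$ (i, j)) 1 = A $$ (i, j)" "poly.coeff (?E $$ (i, j)) 0 = 1\<^sub>m n $$ (i, j)"
    if "i < n" "j < n" for i j
    using A that by auto
  have "add_compound k A $$ (a, b) = poly.coeff (mult_compound k ?E $$ (a, b)) 1"
    using A ab by (simp add: add_compound_def mult_compound_def)
  also have "\<dots> = poly.coeff (\<Sum>p | p permutes {..<k}.
      of_int (sign p) * (\<Prod>m<k. ?E $$ (\<alpha> ! m, \<beta> ! p m))) 1"
  proof -
    have "mult_compound k ?E $$ (a, b)
      = det (mat k k (\<lambda>(r, c). ?E $$ (\<alpha> ! r, \<beta> ! c)))"
      using A ab by (subst mult_compound_index) (simp_all add: \<alpha>_def \<beta>_def)
    also have "\<dots> = (\<Sum>p | p permutes {..<k}. of_int (sign p) * (\<Prod>m<k. ?E $$ (\<alpha> ! m, \<beta> ! p m)))"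
      by (simp only: det_mat split)
    finally show ?thesis
      by simp
  qed
  also have "\<dots> = (\<Sum>p | p permutes {..<k}.
      of_int (sign p) * poly.coeff (\<Prod>m<k. ?E $$ (\<alpha> ! m, \<beta> ! p m)) 1)"
    by (simp add: coeff_sum of_int_poly)
  also have "\<dots> = (\<Sum>p | p permutes {..<k}. of_int (sign p) *
    (\<Sum>l<k. \<Prod>m<k. (if m = l then A else 1\<^sub>m n) $$ (\<alpha> ! m, \<beta> ! p m)))"
  proof (intro sum.cong refl arg_cong2[where f = "(*)"])
    fix p assume "p \<in> {p. p permutes {..<k}}"
    then have p: "p m < k" if "m < k" for m
      using that permutes_in_image[of p "{..<k}" m] by simp
    show "poly.coeff (\<Prod>m<k. ?E $$ (\<alpha> ! m, \<beta> ! p m)) 1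
      = (\<Sum>l<k. \<Prod>m<k. (if m = l then A else 1\<^sub>m n) $$ (\<alpha> ! m, \<beta> ! p m))"
      unfolding coeff_1_prod[OF finite_lessThan]
      by (intro sum.cong prod.cong refl) (use p \<alpha> E in auto)
  qed
  finally show ?thesis
    by (simp add: \<alpha>_def \<beta>_def)
qed

lemma kron_sum_index:
  fixes A :: "'a :: comm_semiring_1 mat"
  assumes "A \<in> carrier_mat n n" "xs \<in> seqs n k" "ys \<in> seqs n k"
  shows "kron_sum k A $$ (seq_index n xs, seq_index n ys)
    = (\<Sum>l<k. \<Prod>m<k. (if m = l then A else 1\<^sub>m n) $$ (xs ! m, ys ! m))"
proof -
  have b: "seq_index n xs < n ^ k" "seq_index n ys < n ^ k"
    using seq_index_less[of xs n] seq_index_less[of ys n] assms by (auto simp: seqs_def)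
  have "kron_list ((replicate k (1\<^sub>m n))[l := A]) $$ (seq_index n xs, seq_index n ys)
    = (\<Prod>m<k. (if m = l then A else 1\<^sub>m n) $$ (xs ! m, ys ! m))" for l
  proof -
    let ?As = "(replicate k (1\<^sub>m n))[l := A]"
    have "set ?As \<subseteq> carrier_mat n n"
      using set_update_subset_insert[of "replicate k (1\<^sub>m n)" l A] assms(1)
      by (auto split: if_splits)
    then have "kron_list ?As $$ (seq_index n xs, seq_index n ys)
      = (\<Prod>m<length ?As. (?As ! m) $$ (xs ! m, ys ! m))"
      by (rule kron_list_index) (use assms in auto)
    also have "\<dots> = (\<Prod>m<k. (if m = l then A else 1\<^sub>m n) $$ (xs ! m, ys ! m))"
      by (intro prod.cong) auto
    finally show ?thesis .
  qed
  then show ?thesis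
    using assms(1) b by (simp add: kron_sum_def mat_sum_def atLeast0LessThan)
qed

theorem theorem5:
  fixes A :: "real mat" and n k :: nat
  assumes "n \<ge> 1" and "A \<in> carrier_mat n n" and "k \<in> {1..n}"
  shows "add_compound k A = L_mat n k * kron_sum k A * M_mat n k"
proof (rule eq_matI)
  have K: "kron_sum k A \<in> carrier_mat (n ^ k) (n ^ k)"
    using assms(2) by (simp add: kron_sum_def mat_sum_def)
  have dims: "dim_row (L_mat n k * kron_sum k A * M_mat n k) = n choose k"
    "dim_col (L_mat n k * kron_sum k A * M_mat n k) = n choose k"
    using L_mat_carrier[of n k, where 'a = real] M_mat_carrier[of n k, where 'a = real] by auto
  then show "dim_row (add_compound k A) = dim_row (L_mat n k * kron_sum k A * M_mat n k)"
    "dim_col (add_compound k A) = dim_col (L_mat n k * kron_sum k A * M_mat n k)"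
    using assms(2) by (auto simp: add_compound_def mult_compound_def)
  fix a b
  assume "a < dim_row (L_mat n k * kron_sum k A * M_mat n k)"
    "b < dim_col (L_mat n k * kron_sum k A * M_mat n k)"
  then have ab: "a < n choose k" "b < n choose k"
    by (simp_all only: dims)
  define \<alpha> \<beta> where "\<alpha> = incr_seqs n k ! a" and "\<beta> = incr_seqs n k ! b"
  have \<alpha>: "\<alpha> \<in> seqs n k" and \<beta>: "\<beta> \<in> seqs n k" "length \<beta> = k"
    using incr_seqs_nth_mem[OF ab(1)] incr_seqs_nth_mem[OF ab(2)]
    by (auto simp: \<alpha>_def \<beta>_def set_incr_seqs seqs_def)
  have "kron_sum k A $$ (seq_index n \<alpha>, seq_index n (permute_list p \<beta>))
    = (\<Sum>l<k. \<Prod>m<k. (if m = l then A else 1\<^sub>m n) $$ (\<alpha> ! m, \<beta> ! p m))"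
    if p: "p permutes {..<k}" for p
  proof -
    have "permute_list p \<beta> \<in> seqs n k"
      using \<beta> p by (simp add: seqs_def)
    then show ?thesis
      using kron_sum_index[OF assms(2) \<alpha>] p \<beta>(2) by (simp add: permute_list_nth)
  qed
  then show "add_compound k A $$ (a, b) = (L_mat n k * kron_sum k A * M_mat n k) $$ (a, b)"
    unfolding add_compound_index[OF assms(2) ab] L_mult_M_index[OF K ab]
    by (intro sum.cong) (simp_all add: \<alpha>_def \<beta>_def)
qed

end
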